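(* Let $1\le d<n$, let $A$ be a real $d\times n$ matrix of rank $d$, let $\mathbf c,\mathbf g\in\mathbb R^n$ be generic vectors, and let $\mathcal C\subset\mathbb P^n\times\mathbb P^n$ be the projective primal-dual central curve. Let $\mathcal H$ be the arrangement $\{x_i=0\}_{i\in[n]}$ in $\mathcal L_A^\perp+\mathbf g$ and $\mathcal H^*$ the arrangement $\{s_i=0\}_{i\in[n]}$ in $\mathcal L_A+\mathbf c$. Then: (a) The primal central curve passes through each vertex of $\mathcal H$ as the dual central curve passes through the corresponding vertex of $\mathcal H^*$: for every vertex $\mathbf x$ of $\mathcal H$ with corresponding (complementary) vertex $\mathbf s$ of $\mathcal H^*$, the pair $(\mathbf x,\mathbf s)$ lies on $\mathcal C$. (b) As the primal curve passes through the analytic center of each bounded region of $\mathcal H$, the dual curve reaches the hyperplane $\{s_0=0\}$: for every bounded region of $\mathcal H$ with analytic center $\mathbf x$ there is a point $(\mathbf x,\mathbf s)\in\mathcal C$ with $s_0=0$. (c) Similarly, as the dual curve reaches the analytic center of each bounded region of $\mathcal H^*$, the primal curve meets the hyperplane $\{x_0=0\}$: for every bounded region of $\mathcal H^*$ with analytic center $\mathbf s$ there is a point $(\mathbf x,\mathbf s)\in\mathcal C$ with $x_0=0$.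
   Context: $\mathcal L_A\subset\mathbb R^n$ is the row space of $A$, $\mathcal L_A^\perp=\ker A$. Generic: the coordinates of $\mathbf c,\mathbf g$ are algebraically independent over the field $\mathbb Q(A)\subset\mathbb R$ generated by the entries of $A$. $\mathbb P^n\times\mathbb P^n$ is complex, with homogeneous coordinates $[x_0:\cdots:x_n]$, $[s_0:\cdots:s_n]$; affine points $\mathbf x,\mathbf s\in\mathbb C^n$ are identified with $[1:\mathbf x]$, $[1:\mathbf s]$. The projective primal-dual central curve $\mathcal C$ is the Zariski closure in $\mathbb P^n\times\mathbb P^n$ of the affine (complex) curve defined by $$\mathbf x\in\mathcal L_A^\perp+\mathbf g,\quad \mathbf s\in\mathcal L_A+\mathbf c,\quad x_1s_1=x_2s_2=\cdots=x_ns_n .$$ Its projections to the two factors are the (projective) primal and dual central curves. Vertices: for each basis $I$ of the matroid $M(\mathcal L_A)$ (a $d$-subset of $[n]$ indexing linearly independent columns of $A$), with complement $J=[n]\setminus I$, there is a unique point $\mathbf x\in\mathcal L_A^\perp+\mathbf g$ with $x_j=0$ for all $j\in J$, which is a vertex of $\mathcal H$, and a unique point $\mathbf s\in\mathcal L_A+\mathbf c$ with $s_i=0$ for all $i\in I$, which is a vertex of $\mathcal H^*$. These two vertices correspond to each other (are complementary); all vertices of $\mathcal H$ and $\mathcal H^*$ arise this way. Regions are connected components of the (real) complement of the hyperplanes. The analytic center of a bounded region of $\mathcal H$ (resp. $\mathcal H^*$) is the unique point in it maximizing $\sum_i\log|x_i|$ (resp. $\sum_i\log|s_i|$). *)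

theory Defs
  imports "HOL-Analysis.Analysis" "HOL-Library.Poly_Mapping"
begin

section \<open>Multivariate polynomials\<close>

text \<open>A polynomial with variables indexed by \<open>'v\<close> is a finitely supported map from monomials
  (finitely supported exponent maps) to coefficients.\<close>

type_synonym ('v, 'a) mpoly = "('v \<Rightarrow>\<^sub>0 nat) \<Rightarrow>\<^sub>0 'a"

definition mpoly_eval :: "('v, 'a::comm_semiring_1) mpoly \<Rightarrow> ('v \<Rightarrow> 'a) \<Rightarrow> 'a" where
  "mpoly_eval p f =
     (\<Sum>m\<in>Poly_Mapping.keys p.
        Poly_Mapping.lookup p m * (\<Prod>v\<in>Poly_Mapping.keys m. f v ^ Poly_Mapping.lookup m v))"

definition subfield_set :: "'a::field set \<Rightarrow> bool" where
  "subfield_set K \<longleftrightarrow> 0 \<in> K \<and> 1 \<in> K \<and>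
     (\<forall>x\<in>K. \<forall>y\<in>K. x + y \<in> K \<and> x * y \<in> K) \<and> (\<forall>x\<in>K. - x \<in> K \<and> inverse x \<in> K)"

definition alg_independent_over :: "'a::field set \<Rightarrow> ('v \<Rightarrow> 'a) \<Rightarrow> bool" where
  "alg_independent_over K f \<longleftrightarrow>
     (\<forall>p. range (Poly_Mapping.lookup p) \<subseteq> K \<and> mpoly_eval p f = 0 \<longrightarrow> p = 0)"

text \<open>The hull is the field \<open>\<rat>(A)\<close>. The two vectors are joined into one family indexed by
  \<open>'n + 'n\<close>, so independence is that of all their coordinates together.\<close>

definition generic :: "real^'n^'d \<Rightarrow> real^'n \<Rightarrow> real^'n \<Rightarrow> bool" where
  "generic A c g \<longleftrightarrow>
     alg_independent_over (subfield_set hull {A $ i $ j | i j. True})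
       (case_sum (($) c) (($) g))"


section \<open>The two affine spaces\<close>

text \<open>These are stated over an arbitrary field, since they are needed over the reals (for the
  arrangements) and over the complex numbers (for the curve).\<close>

definition row_space :: "'a::field^'n^'d \<Rightarrow> ('a^'n) set" where
  "row_space A = vec.span (rows A)"

definition mat_kernel :: "'a::field^'n^'d \<Rightarrow> ('a^'n) set" where
  "mat_kernel A = {x. A *v x = 0}"

definition primal_space :: "'a::field^'n^'d \<Rightarrow> 'a^'n \<Rightarrow> ('a^'n) set" where
  "primal_space A g = (\<lambda>x. x + g) ` mat_kernel A"

definition dual_space :: "'a::field^'n^'d \<Rightarrow> 'a^'n \<Rightarrow> ('a^'n) set" where
  "dual_space A c = (\<lambda>s. s + c) ` row_space A"


section \<open>Hyperplane arrangements\<close>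

text \<open>For an affine space \<open>S\<close>, the arrangement consists of the sets \<open>{x \<in> S. x $ i = 0}\<close>.
  A vertex is a point that is the only common point of the hyperplanes through it.\<close>

definition vertices :: "(real^'n) set \<Rightarrow> (real^'n) set" where
  "vertices S = {x \<in> S. {y \<in> S. \<forall>i. x $ i = 0 \<longrightarrow> y $ i = 0} = {x}}"

definition regions :: "(real^'n) set \<Rightarrow> (real^'n) set set" where
  "regions S = components (S - (\<Union>i. {x. x $ i = 0}))"

definition analytic_center :: "(real^'n) set \<Rightarrow> real^'n" where
  "analytic_center R = (THE x. is_arg_max (\<lambda>x. \<Sum>i\<in>UNIV. ln \<bar>x $ i\<bar>) (\<lambda>x. x \<in> R) x)"

definition matroid_basis :: "real^'n^'d \<Rightarrow> 'n set \<Rightarrow> bool" where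
  "matroid_basis A I \<longleftrightarrow>
     card I = CARD('d) \<and> inj_on (\<lambda>i. column i A) I \<and> independent ((\<lambda>i. column i A) ` I)"

definition complementary ::
    "real^'n^'d \<Rightarrow> real^'n \<Rightarrow> real^'n \<Rightarrow> real^'n \<Rightarrow> real^'n \<Rightarrow> bool" where
  "complementary A c g x s \<longleftrightarrow>
     (\<exists>I. matroid_basis A I \<and>
          x \<in> primal_space A g \<and> (\<forall>j. j \<notin> I \<longrightarrow> x $ j = 0) \<and>
          s \<in> dual_space A c \<and> (\<forall>i\<in>I. s $ i = 0))"


section \<open>The projective primal-dual central curve\<close>

text \<open>Homogeneous coordinates on \<open>\<bbbP>\<^sup>n\<close> are indexed by \<open>'n option\<close>, with \<open>None\<close> as the index
  \<open>0\<close>. A point is represented by its nonzero coordinate vectors; the closed sets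
  below are invariant under rescaling either vector.\<close>

definition bihomogeneous :: "('i + 'i, 'a::zero) mpoly \<Rightarrow> bool" where
  "bihomogeneous p \<longleftrightarrow>
     (\<exists>a b. \<forall>m\<in>Poly_Mapping.keys p.
        (\<Sum>v | Inl v \<in> Poly_Mapping.keys m. Poly_Mapping.lookup m (Inl v)) = a \<and>
        (\<Sum>v | Inr v \<in> Poly_Mapping.keys m. Poly_Mapping.lookup m (Inr v)) = b)"

definition zariski_closed :: "(('a::field^'i) \<times> ('a^'i)) set \<Rightarrow> bool" where
  "zariski_closed Z \<longleftrightarrow>
     (\<exists>F. (\<forall>p\<in>F. bihomogeneous p) \<and>
          Z = {(X, S). X \<noteq> 0 \<and> S \<noteq> 0 \<and>
                 (\<forall>p\<in>F. mpoly_eval p (case_sum (($) X) (($) S)) = 0)})"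

definition homog :: "'a::one^'n \<Rightarrow> 'a^('n option)" where
  "homog x = (\<chi> k. case k of None \<Rightarrow> 1 | Some i \<Rightarrow> x $ i)"

definition cvec :: "real^'n \<Rightarrow> complex^'n" where
  "cvec x = (\<chi> i. complex_of_real (x $ i))"

definition cmat :: "real^'n^'d \<Rightarrow> complex^'n^'d" where
  "cmat A = (\<chi> i. cvec (A $ i))"

definition affine_central_curve ::
    "real^'n^'d \<Rightarrow> real^'n \<Rightarrow> real^'n \<Rightarrow> ((complex^'n) \<times> (complex^'n)) set" where
  "affine_central_curve A c g =
     {(x, s). x \<in> primal_space (cmat A) (cvec g) \<and> s \<in> dual_space (cmat A) (cvec c) \<and>
              (\<forall>i j. x $ i * s $ i = x $ j * s $ j)}"

definition central_curve ::
    "real^'n^'d \<Rightarrow> real^'n \<Rightarrow> real^'n \<Rightarrow> ((complex^('n option)) \<times> (complex^('n option))) set" where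
  "central_curve A c g =
     zariski_closed hull ((\<lambda>(x, s). (homog x, homog s)) ` affine_central_curve A c g)"


section \<open>Bases and vertices\<close>

lemma primal_space_iff: "x \<in> primal_space A g \<longleftrightarrow> A *v x = A *v g" for A :: "real^'n^'d"
proof -
  have "x \<in> primal_space A g \<longleftrightarrow> x - g \<in> mat_kernel A"
    unfolding primal_space_def by (force simp: image_iff)
  then show ?thesis by (simp add: mat_kernel_def matrix_vector_mult_diff_distrib)
qed

lemma row_space_eq: "row_space A = range (\<lambda>y. y v* A)" for A :: "real^'n^'d"
proof -
  have sub: "subspace (range (\<lambda>y. y v* A))"
    by (rule linear_subspace_image) (auto simp: linear_iff vector_matrix_left_distrib scaleR_vector_matrix_assoc)
  have "row i A = axis i 1 v* A" for i
    by (simp add: vec_eq_iff row_def vector_matrix_mult_def axis_def if_distrib[of "\<lambda>z. z * _"]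
        if_distribR cong: if_cong)
  then have "rows A \<subseteq> range (\<lambda>y. y v* A)"
    by (auto simp: rows_def)
  moreover have "y v* A \<in> span (rows A)" for y
  proof -
    have "y v* A = (\<Sum>i\<in>UNIV. y $ i *\<^sub>R row i A)"
      by (simp add: vec_eq_iff row_def vector_matrix_mult_def mult.commute)
    also have "\<dots> \<in> span (rows A)"
      by (intro span_sum span_scale span_base) (auto simp: rows_def)
    finally show ?thesis .
  qed
  ultimately show ?thesis
    unfolding row_space_def span_vec_eq using span_minimal[OF _ sub] by blast
qed

lemma vector_matrix_nth: "(y v* A) $ i = y \<bullet> column i A" for A :: "real^'n^'d"
  by (simp add: vector_matrix_mult_def column_def inner_vec_def mult.commute)

lemma dual_space_iff: "s \<in> dual_space A c \<longleftrightarrow> (\<exists>y. \<forall>i. s $ i = y \<bullet> column i A + c $ i)"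
  for A :: "real^'n^'d"
proof -
  have "s \<in> dual_space A c \<longleftrightarrow> (\<exists>y. s = y v* A + c)"
    unfolding dual_space_def row_space_eq by auto
  then show ?thesis by (simp add: vec_eq_iff vector_matrix_nth)
qed

lemma independent_family_iff:
  fixes f :: "'i::finite \<Rightarrow> 'b::real_vector"
  shows "inj_on f I \<and> independent (f ` I) \<longleftrightarrow>
     (\<forall>u. (\<Sum>i\<in>I. u i *\<^sub>R f i) = 0 \<longrightarrow> (\<forall>i\<in>I. u i = 0))" (is "?L \<longleftrightarrow> ?R")
proof
  assume L: ?L
  show ?R
  proof (intro allI impI)
    fix u assume u: "(\<Sum>i\<in>I. u i *\<^sub>R f i) = 0"
    have inj: "inj_on f I" and ind: "independent (f ` I)" using L by auto
    have "(\<Sum>v\<in>f ` I. u (inv_into I f v) *\<^sub>R v) = (\<Sum>i\<in>I. u i *\<^sub>R f i)"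
      by (simp add: sum.reindex[OF inj] inv_into_f_f[OF inj])
    then have sum0: "(\<Sum>v\<in>f ` I. u (inv_into I f v) *\<^sub>R v) = 0" using u by simp
    have "u (inv_into I f (f i)) = 0" if "i \<in> I" for i
      using that by (intro independentD[OF ind _ order_refl sum0]) simp_all
    then show "\<forall>i\<in>I. u i = 0" by (simp add: inv_into_f_f[OF inj])
  qed
next
  assume R: ?R
  have inj: "inj_on f I"
  proof (rule inj_onI, rule ccontr)
    fix i j assume ij: "i \<in> I" "j \<in> I" "f i = f j" "i \<noteq> j"
    let ?u = "\<lambda>k. if k = i then 1 else if k = j then -1 else (0::real)"
    have "(\<Sum>k\<in>I. ?u k *\<^sub>R f k) = (\<Sum>k\<in>{i,j}. ?u k *\<^sub>R f k)"
      by (rule sum.mono_neutral_right) (use ij in auto)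
    also have "\<dots> = 0" using ij by simp
    finally have "?u i = 0" using R[rule_format, of ?u] ij by blast
    then show False by simp
  qed
  moreover have "independent (f ` I)"
  proof
    assume "dependent (f ` I)"
    then obtain u where u: "\<exists>v\<in>f ` I. u v \<noteq> 0" "(\<Sum>v\<in>f ` I. u v *\<^sub>R v) = 0"
      using dependent_finite[of "f ` I"] by auto
    have "(\<Sum>i\<in>I. u (f i) *\<^sub>R f i) = 0" using u(2) by (simp add: sum.reindex[OF inj])
    then have "\<forall>i\<in>I. u (f i) = 0" using R[rule_format, of "\<lambda>i. u (f i)"] by blast
    then show False using u(1) by blast
  qed
  ultimately show ?L by (rule conjI)
qed

lemma matrix_vector_columns:
  fixes A :: "real^'n^'d"
  assumes "\<And>i. i \<notin> I \<Longrightarrow> x $ i = 0"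
  shows "A *v x = (\<Sum>i\<in>I. x $ i *\<^sub>R column i A)"
proof -
  have "A *v x = (\<Sum>i\<in>UNIV. x $ i *\<^sub>R column i A)"
    by (simp add: matrix_mult_sum scalar_mult_eq_scaleR)
  also have "\<dots> = (\<Sum>i\<in>I. x $ i *\<^sub>R column i A)"
    by (rule sum.mono_neutral_right) (use assms in auto)
  finally show ?thesis .
qed

lemma matroid_basis_span:
  fixes A :: "real^'n^'d"
  assumes "matroid_basis A I"
  shows "span ((\<lambda>i. column i A) ` I) = UNIV"
proof -
  have "card ((\<lambda>i. column i A) ` I) = DIM(real^'d)"
    using assms by (simp add: matroid_basis_def card_image)
  then show ?thesis
    using assms card_ge_dim_independent[of "(\<lambda>i. column i A) ` I" UNIV]
    by (auto simp: matroid_basis_def)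
qed

lemma matroid_basis_between:
  fixes A :: "real^'n^'d"
  assumes F: "inj_on (\<lambda>i. column i A) F" "independent ((\<lambda>i. column i A) ` F)"
    and FG: "F \<subseteq> G" and G: "span ((\<lambda>i. column i A) ` G) = UNIV"
  obtains I where "matroid_basis A I" "F \<subseteq> I" "I \<subseteq> G"
proof -
  let ?f = "\<lambda>i. column i A"
  obtain B where B: "?f ` F \<subseteq> B" "B \<subseteq> ?f ` G" "independent B" "?f ` G \<subseteq> span B"
    using maximal_independent_subset_extend[OF image_mono[OF FG] F(2)] by metis
  have "span (?f ` G) \<subseteq> span B" by (rule span_minimal[OF B(4) subspace_span])
  then have spanB: "span B = UNIV" using G by auto
  define h where "h = inv_into G ?f"
  have h: "?f (h b) = b" "h b \<in> G" if "b \<in> B" for b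
  proof -
    have "b \<in> ?f ` G" using that B(2) by blast
    then show "?f (h b) = b" "h b \<in> G" unfolding h_def by (rule f_inv_into_f, rule inv_into_into)
  qed
  define I where "I = F \<union> h ` (B - ?f ` F)"
  have "?f ` h ` (B - ?f ` F) = (\<lambda>b. b) ` (B - ?f ` F)"
    unfolding image_image by (rule image_cong[OF refl]) (rule h(1), blast)
  then have im: "?f ` I = B"
    using B(1) by (auto simp only: I_def image_Un image_ident)
  have "inj_on ?f (h ` (B - ?f ` F))"
  proof (rule inj_onI)
    fix i j assume "i \<in> h ` (B - ?f ` F)" "j \<in> h ` (B - ?f ` F)" and eq: "?f i = ?f j"
    then obtain a b where "a \<in> B" "i = h a" "b \<in> B" "j = h b" by blast
    with eq show "i = j" using h(1)[of a] h(1)[of b] by simp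
  qed
  moreover have "?f i \<noteq> ?f j" if "i \<in> F" "j \<in> h ` (B - ?f ` F)" for i j
    using that h(1) by force
  ultimately have inj: "inj_on ?f I"
    unfolding I_def inj_on_Un using F(1) by blast
  have "card I = card B" using card_image[OF inj] im by simp
  also have "card B = dim (UNIV :: (real^'d) set)"
    using dim_eq_card[of B UNIV] B(3) spanB by simp
  finally have "matroid_basis A I" using im inj B(3) by (simp add: matroid_basis_def)
  moreover have "I \<subseteq> G" using FG h(2) by (auto simp: I_def)
  ultimately show thesis using that by (simp add: I_def)
qed

lemma span_columns_UNIV:
  fixes A :: "real^'n^'d"
  assumes "rank A = CARD('d)"
  shows "span (range (\<lambda>i. column i A)) = UNIV"
proof -
  have "dim (columns A) = DIM(real^'d)" using assms by (simp add: column_rank_def)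
  then have "span (columns A) = UNIV" using dim_eq_full by blast
  moreover have "columns A = range (\<lambda>i. column i A)" by (auto simp: columns_def)
  ultimately show ?thesis by simp
qed

text \<open>The following facts show that each basis determines exactly one pair of complementary points,
  and that the points arising in this way are precisely the vertices of the two arrangements.\<close>

lemma primal_vertex_ex1:
  fixes A :: "real^'n^'d"
  assumes I: "matroid_basis A I"
  shows "\<exists>!x. x \<in> primal_space A g \<and> (\<forall>j. j \<notin> I \<longrightarrow> x $ j = 0)"
proof (rule ex_ex1I)
  let ?f = "\<lambda>i. column i A"
  have inj: "inj_on ?f I" using I by (simp add: matroid_basis_def)
  have "A *v g \<in> span (?f ` I)" using matroid_basis_span[OF I] by simp
  then obtain u where "A *v g = (\<Sum>v\<in>?f ` I. u v *\<^sub>R v)" by (auto simp: span_finite)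
  then have u: "A *v g = (\<Sum>i\<in>I. u (?f i) *\<^sub>R ?f i)" by (simp add: sum.reindex[OF inj])
  define x :: "real^'n" where "x = (\<chi> i. if i \<in> I then u (?f i) else 0)"
  have "A *v x = (\<Sum>i\<in>I. x $ i *\<^sub>R ?f i)" by (rule matrix_vector_columns) (simp add: x_def)
  also have "\<dots> = A *v g" unfolding u by (rule sum.cong) (simp_all add: x_def)
  finally have "x \<in> primal_space A g" by (simp add: primal_space_iff)
  then show "\<exists>x. x \<in> primal_space A g \<and> (\<forall>j. j \<notin> I \<longrightarrow> x $ j = 0)"
    by (intro exI[of _ x]) (simp add: x_def)
next
  fix x y assume x: "x \<in> primal_space A g \<and> (\<forall>j. j \<notin> I \<longrightarrow> x $ j = 0)"
    and y: "y \<in> primal_space A g \<and> (\<forall>j. j \<notin> I \<longrightarrow> y $ j = 0)"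
  have "(\<Sum>i\<in>I. (x $ i - y $ i) *\<^sub>R column i A) = A *v (x - y)"
    using matrix_vector_columns[of I "x - y" A] x y by simp
  also have "\<dots> = 0" using x y by (simp add: primal_space_iff matrix_vector_mult_diff_distrib)
  finally have sum0: "(\<Sum>i\<in>I. (x $ i - y $ i) *\<^sub>R column i A) = 0" .
  have "\<forall>u. (\<Sum>i\<in>I. u i *\<^sub>R column i A) = 0 \<longrightarrow> (\<forall>i\<in>I. u i = 0)"
    using I unfolding matroid_basis_def independent_family_iff[symmetric] by blast
  from this[rule_format, OF sum0] have "\<forall>i\<in>I. x $ i - y $ i = 0" by (rule ballI)
  then have "x $ i = y $ i" for i using x y by (cases "i \<in> I") auto
  then show "x = y" by (simp add: vec_eq_iff)
qed

lemma dual_vertex_ex1: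
  fixes A :: "real^'n^'d"
  assumes I: "matroid_basis A I"
  shows "\<exists>!s. s \<in> dual_space A c \<and> (\<forall>i\<in>I. s $ i = 0)"
proof (rule ex_ex1I)
  let ?f = "\<lambda>i. column i A"
  have inj: "inj_on ?f I" and ind: "independent (?f ` I)"
    using I by (simp_all add: matroid_basis_def)
  obtain h :: "real^'d \<Rightarrow> real" where h: "linear h" "\<And>v. v \<in> ?f ` I \<Longrightarrow> h v = - c $ inv_into I ?f v"
    using linear_independent_extend[OF ind, of "\<lambda>v. - c $ inv_into I ?f v"] by auto
  define y where "y = adjoint h 1"
  have y: "y \<bullet> v = h v" for v
    using adjoint_works[OF h(1), of v 1] by (simp add: y_def inner_commute)
  define s :: "real^'n" where "s = (\<chi> i. y \<bullet> ?f i + c $ i)"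
  have "s \<in> dual_space A c" unfolding dual_space_iff by (auto simp: s_def)
  moreover have "\<forall>i\<in>I. s $ i = 0" by (simp add: s_def y h(2) inv_into_f_f[OF inj])
  ultimately show "\<exists>s. s \<in> dual_space A c \<and> (\<forall>i\<in>I. s $ i = 0)" by blast
next
  fix s t assume "s \<in> dual_space A c \<and> (\<forall>i\<in>I. s $ i = 0)"
    and "t \<in> dual_space A c \<and> (\<forall>i\<in>I. t $ i = 0)"
  then obtain y z where s: "\<And>i. s $ i = y \<bullet> column i A + c $ i" "\<forall>i\<in>I. s $ i = 0"
    and t: "\<And>i. t $ i = z \<bullet> column i A + c $ i" "\<forall>i\<in>I. t $ i = 0"
    unfolding dual_space_iff by blast
  have "orthogonal (y - z) v" if "v \<in> (\<lambda>i. column i A) ` I" for v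
    using that s t by (force simp: orthogonal_def inner_diff_left)
  then have "orthogonal (y - z) v" for v
    using orthogonal_to_span[of v "(\<lambda>i. column i A) ` I" "y - z"] matroid_basis_span[OF I] by auto
  then have "y = z" using orthogonal_self[of "y - z"] by simp
  then show "s = t" by (subst vec_eq_iff) (simp add: s(1) t(1))
qed

lemma primal_vertices_iff:
  fixes A :: "real^'n^'d"
  assumes "rank A = CARD('d)"
  shows "x \<in> vertices (primal_space A g) \<longleftrightarrow>
    (\<exists>I. matroid_basis A I \<and> x \<in> primal_space A g \<and> (\<forall>j. j \<notin> I \<longrightarrow> x $ j = 0))"
    (is "?L \<longleftrightarrow> ?R")
proof
  assume ?R
  then obtain I where I: "matroid_basis A I" "x \<in> primal_space A g" "\<forall>j. j \<notin> I \<longrightarrow> x $ j = 0" by blast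
  have "y = x" if "y \<in> primal_space A g" "\<forall>i. x $ i = 0 \<longrightarrow> y $ i = 0" for y
    using primal_vertex_ex1[OF I(1), of g] I that by blast
  then show ?L using I by (auto simp: vertices_def)
next
  assume L: ?L
  then have xg: "A *v x = A *v g" by (simp add: vertices_def primal_space_iff)
  define F where "F = {i. x $ i \<noteq> 0}"
  have "inj_on (\<lambda>i. column i A) F \<and> independent ((\<lambda>i. column i A) ` F)"
    unfolding independent_family_iff
  proof (intro allI impI)
    fix u assume u: "(\<Sum>i\<in>F. u i *\<^sub>R column i A) = 0"
    define z :: "real^'n" where "z = (\<chi> i. if i \<in> F then u i else 0)"
    have "A *v z = (\<Sum>i\<in>F. z $ i *\<^sub>R column i A)" by (rule matrix_vector_columns) (simp add: z_def)
    also have "\<dots> = 0" unfolding u[symmetric] by (rule sum.cong) (simp_all add: z_def)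
    finally have "x + z \<in> {y \<in> primal_space A g. \<forall>i. x $ i = 0 \<longrightarrow> y $ i = 0}"
      by (simp add: primal_space_iff matrix_vector_right_distrib xg) (simp add: z_def F_def)
    then have "x + z = x" using L unfolding vertices_def by blast
    then have "z = 0" by simp
    have "u i = z $ i" if "i \<in> F" for i using that by (simp add: z_def)
    then show "\<forall>i\<in>F. u i = 0" using \<open>z = 0\<close> by simp
  qed
  then obtain I where "matroid_basis A I" "F \<subseteq> I"
    using matroid_basis_between[of A F UNIV] span_columns_UNIV[OF assms] by auto
  then show ?R using L by (auto simp: vertices_def F_def)
qed

lemma dual_vertices_iff:
  fixes A :: "real^'n^'d"
  assumes "rank A = CARD('d)"
  shows "s \<in> vertices (dual_space A c) \<longleftrightarrow>
    (\<exists>I. matroid_basis A I \<and> s \<in> dual_space A c \<and> (\<forall>i\<in>I. s $ i = 0))"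
    (is "?L \<longleftrightarrow> ?R")
proof
  assume ?R
  then obtain I where I: "matroid_basis A I" "s \<in> dual_space A c" "\<forall>i\<in>I. s $ i = 0" by blast
  have "y = s" if "y \<in> dual_space A c" "\<forall>i. s $ i = 0 \<longrightarrow> y $ i = 0" for y
    using dual_vertex_ex1[OF I(1), of c] I that by blast
  then show ?L using I by (auto simp: vertices_def)
next
  assume L: ?L
  define Z where "Z = {i. s $ i = 0}"
  have "span ((\<lambda>i. column i A) ` Z) = UNIV"
  proof (rule ccontr)
    assume "\<not> ?thesis"
    then obtain a where a: "a \<noteq> 0" "\<And>v. v \<in> span ((\<lambda>i. column i A) ` Z) \<Longrightarrow> a \<bullet> v = 0"
      using span_not_UNIV_orthogonal by blast
    have aZ: "a \<bullet> column i A = 0" if "i \<in> Z" for i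
      using a(2) that by (simp add: span_base)
    obtain y where y: "\<And>i. s $ i = y \<bullet> column i A + c $ i"
      using L by (auto simp: vertices_def dual_space_iff)
    define t :: "real^'n" where "t = (\<chi> i. s $ i + a \<bullet> column i A)"
    have "t \<in> dual_space A c"
      unfolding dual_space_iff by (intro exI[of _ "y + a"]) (simp add: t_def y inner_add_left)
    then have "t \<in> {y \<in> dual_space A c. \<forall>i. s $ i = 0 \<longrightarrow> y $ i = 0}"
      using aZ by (simp add: t_def Z_def)
    then have "t = s" using L by (auto simp: vertices_def)
    then have "a \<bullet> column i A = 0" for i by (simp add: t_def vec_eq_iff)
    then have "orthogonal a a"
      using orthogonal_to_span[of a "range (\<lambda>i. column i A)" a] span_columns_UNIV[OF assms]
      by (auto simp: orthogonal_def)
    then show False using a(1) by (simp add: orthogonal_self)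
  qed
  then obtain I where "matroid_basis A I" "I \<subseteq> Z"
    using matroid_basis_between[of A "{}" Z] by (auto simp: independent_empty)
  then show ?R using L by (auto simp: vertices_def Z_def)
qed

end

theory Submission
  imports Defs
begin

text \<open>A pair of complementary vertices satisfies \<open>x\<^sub>i s\<^sub>i = 0\<close> for all \<open>i\<close>, so it already lies on the
  affine curve. For the other two parts, let \<open>R\<close> be a bounded region of an arrangement in \<open>L + v\<close> and
  let \<open>w\<close> be arbitrary. For small \<open>e > 0\<close> the maximiser \<open>y\<close> of \<open>\<Sum>\<^sub>i log \<bar>y\<^sub>i\<bar> - e (w \<bullet> y)\<close> on \<open>R\<close>
  satisfies \<open>1/y - e w \<in> L\<^sup>\<bottom>\<close>, so \<open>y\<close> and \<open>(1/e) (1/y) \<in> L\<^sup>\<bottom> + w\<close> form a point of the central curve, with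
  all coordinate products equal to \<open>1/e\<close>. As \<open>e\<close> tends to 0, \<open>y\<close> tends to the analytic center of \<open>R\<close>,
  while the projective point \<open>[1 : (1/e) (1/y)] = [e : 1/y]\<close> tends to the hyperplane at infinity.\<close>

section \<open>Zariski closed sets\<close>

text \<open>Every monomial of bidegree \<open>(a, b)\<close> picks up the same factor
  \<open>l ^ a * r ^ b\<close>, so vanishing at a point survives any change of representatives. The
  assumption is \<open>bihomogeneous\<close> with its two degrees named, as they occur in the
  conclusion.\<close>

lemma mpoly_eval_scale:
  fixes p :: "('i::finite + 'i, 'a::comm_semiring_1) mpoly"
  assumes "\<And>m. m \<in> Poly_Mapping.keys p \<Longrightarrow>
      (\<Sum>v | Inl v \<in> Poly_Mapping.keys m. Poly_Mapping.lookup m (Inl v)) = a \<and>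
      (\<Sum>v | Inr v \<in> Poly_Mapping.keys m. Poly_Mapping.lookup m (Inr v)) = b"
  shows "mpoly_eval p (case_sum (\<lambda>i. l * X i) (\<lambda>i. r * S i)) =
    l ^ a * r ^ b * mpoly_eval p (case_sum X S)"
proof -
  have "(\<Prod>v\<in>Poly_Mapping.keys m. case_sum (\<lambda>i. l * X i) (\<lambda>i. r * S i) v ^ Poly_Mapping.lookup m v) =
      l ^ a * r ^ b * (\<Prod>v\<in>Poly_Mapping.keys m. case_sum X S v ^ Poly_Mapping.lookup m v)"
    if m: "m \<in> Poly_Mapping.keys p" for m
  proof -
    let ?K = "Poly_Mapping.keys m" and ?c = "case_sum (\<lambda>_::'i. l) (\<lambda>_::'i. r)"
    have split: "case_sum (\<lambda>i. l * X i) (\<lambda>i. r * S i) v = ?c v * case_sum X S v" for v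
      by (cases v) auto
    \<comment> \<open>Splitting the variables into the two blocks turns the scaling factor into one
      power of \<open>l\<close> and one of \<open>r\<close>, whose exponents are the two partial
      degrees.\<close>
    have K: "?K = Inl ` {v. Inl v \<in> ?K} \<union> Inr ` {v. Inr v \<in> ?K}" (is "_ = ?P \<union> ?Q")
      by (auto simp: image_iff) (metis sum.exhaust)
    have "(\<Prod>v\<in>?K. ?c v ^ Poly_Mapping.lookup m v) =
        (\<Prod>v\<in>?P. ?c v ^ Poly_Mapping.lookup m v) * (\<Prod>v\<in>?Q. ?c v ^ Poly_Mapping.lookup m v)"
      by (subst K, rule prod.union_disjoint) auto
    also have "\<dots> = l ^ a * r ^ b"
      using assms[OF m] by (simp add: prod.reindex inj_on_def power_sum[symmetric])
    finally show ?thesis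
      by (simp add: split power_mult_distrib prod.distrib)
  qed
  then show ?thesis
    by (auto simp: mpoly_eval_def sum_distrib_left mult_ac intro!: sum.cong)
qed

lemma tendsto_mpoly_eval:
  fixes p :: "('v, 'a::real_normed_field) mpoly"
  assumes "\<And>v. ((\<lambda>k. f k v) \<longlongrightarrow> h v) F"
  shows "((\<lambda>k. mpoly_eval p (f k)) \<longlongrightarrow> mpoly_eval p h) F"
  unfolding mpoly_eval_def by (intro tendsto_intros assms)

text \<open>Zariski closed sets are closed in the Euclidean topology, since polynomials are
  continuous. A projective limit may only become visible after rescaling, so the representatives
  carry factors \<open>l k\<close> and \<open>r k\<close> that vary with \<open>k\<close>.\<close>

lemma zariski_closed_limit:
  fixes Z :: "((complex^'i) \<times> (complex^'i)) set"
  assumes Z: "zariski_closed Z" and XS: "\<And>k. (X k, S k) \<in> Z"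
    and X: "(\<lambda>k. l k *s X k) \<longlonglongrightarrow> X'" "X' \<noteq> 0"
    and S: "(\<lambda>k. r k *s S k) \<longlonglongrightarrow> S'" "S' \<noteq> 0"
  shows "(X', S') \<in> Z"
proof -
  obtain F where F: "\<And>p. p \<in> F \<Longrightarrow> bihomogeneous p"
    and Zeq: "Z = {(X, S). X \<noteq> 0 \<and> S \<noteq> 0 \<and>
                 (\<forall>p\<in>F. mpoly_eval p (case_sum (($) X) (($) S)) = 0)}"
    using Z unfolding zariski_closed_def by blast
  have "mpoly_eval p (case_sum (($) X') (($) S')) = 0" if p: "p \<in> F" for p
  proof -
    let ?f = "\<lambda>k. case_sum (\<lambda>i. l k * X k $ i) (\<lambda>i. r k * S k $ i)"
    obtain a b where ab: "\<And>m. m \<in> Poly_Mapping.keys p \<Longrightarrow>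
        (\<Sum>v | Inl v \<in> Poly_Mapping.keys m. Poly_Mapping.lookup m (Inl v)) = a \<and>
        (\<Sum>v | Inr v \<in> Poly_Mapping.keys m. Poly_Mapping.lookup m (Inr v)) = b"
      using F[OF p] unfolding bihomogeneous_def by blast
    have "mpoly_eval p (?f k) = 0" for k
      using mpoly_eval_scale[of p a b, OF ab] XS[of k] p by (simp add: Zeq)
    moreover have "(\<lambda>k. mpoly_eval p (?f k)) \<longlonglongrightarrow> mpoly_eval p (case_sum (($) X') (($) S'))"
    proof (rule tendsto_mpoly_eval)
      show "(\<lambda>k. ?f k v) \<longlonglongrightarrow> case_sum (($) X') (($) S') v" for v
        using tendsto_vec_nth[OF X(1)] tendsto_vec_nth[OF S(1)] by (cases v) auto
    qed
    ultimately show ?thesis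
      by (simp add: LIMSEQ_const_iff)
  qed
  then show ?thesis
    using X(2) S(2) by (simp add: Zeq)
qed

section \<open>Complexification\<close>

lemma cmat_mult_cvec: "cmat A *v cvec x = cvec (A *v x)"
  by (simp add: vec_eq_iff cmat_def cvec_def matrix_vector_mult_def)

lemma cvec_primal_space:
  fixes A :: "real^'n^'d"
  assumes "x \<in> primal_space A g"
  shows "cvec x \<in> primal_space (cmat A) (cvec g)"
proof -
  obtain u where u: "A *v u = 0" "x = u + g"
    using assms by (auto simp: primal_space_def mat_kernel_def)
  have "cmat A *v cvec u = 0"
    unfolding cmat_mult_cvec u(1) by (simp add: cvec_def vec_eq_iff)
  moreover have "cvec x = cvec u + cvec g"
    by (simp add: u(2) cvec_def vec_eq_iff)
  ultimately show ?thesis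
    by (simp add: primal_space_def mat_kernel_def)
qed

lemma cvec_dual_space:
  fixes A :: "real^'n^'d"
  assumes "s \<in> dual_space A c"
  shows "cvec s \<in> dual_space (cmat A) (cvec c)"
proof -
  obtain y where y: "\<And>i. s $ i = y \<bullet> column i A + c $ i"
    using assms unfolding dual_space_iff by blast
  \<comment> \<open>The real coefficients of the rows serve unchanged as complex ones.\<close>
  have "(\<Sum>i\<in>UNIV. cvec y $ i *s row i (cmat A)) \<in> row_space (cmat A)"
    unfolding row_space_def
    by (intro vec.span_sum vec.span_scale vec.span_base) (auto simp: rows_def)
  moreover have "cvec s = (\<Sum>i\<in>UNIV. cvec y $ i *s row i (cmat A)) + cvec c"
    by (simp add: vec_eq_iff y cvec_def cmat_def row_def column_def inner_vec_def)
  ultimately show ?thesis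
    unfolding dual_space_def by blast
qed

lemma affine_central_curveI:
  fixes A :: "real^'n^'d"
  assumes "x \<in> primal_space A g" "s \<in> dual_space A c" "\<And>i. x $ i * s $ i = t"
  shows "(cvec x, cvec s) \<in> affine_central_curve A c g"
proof -
  have "cvec x $ i * cvec s $ i = of_real t" for i
    by (simp add: cvec_def flip: assms(3)[of i])
  then show ?thesis
    using cvec_primal_space[OF assms(1)] cvec_dual_space[OF assms(2)]
    by (simp add: affine_central_curve_def)
qed

text \<open>The curve is the intersection of all Zariski closed sets containing the affine curve,
  and each of them contains the limit.\<close>

lemma central_curve_limit:
  fixes A :: "real^'n^'d"
  assumes "\<And>k. (x k, s k) \<in> affine_central_curve A c g"
    and "(\<lambda>k. l k *s homog (x k)) \<longlonglongrightarrow> X" "X \<noteq> 0"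
    and "(\<lambda>k. r k *s homog (s k)) \<longlonglongrightarrow> S" "S \<noteq> 0"
  shows "(X, S) \<in> central_curve A c g"
  unfolding central_curve_def hull_def
proof (intro InterI, elim CollectE conjE)
  fix Z :: "((complex^('n option)) \<times> (complex^('n option))) set"
  assume "zariski_closed Z"
    and sub: "(\<lambda>(x, s). (homog x, homog s)) ` affine_central_curve A c g \<subseteq> Z"
  have "(homog (x k), homog (s k)) \<in> Z" for k
    using sub assms(1)[of k] by auto
  then show "(X, S) \<in> Z"
    by (rule zariski_closed_limit[OF \<open>zariski_closed Z\<close> _ assms(2-5)])
qed

section \<open>Tilted analytic centers of a bounded region\<close>

text \<open>A region is an open sign cell, with the signs read off from a reference point
  \<open>a\<close>. Connectedness and the intermediate value theorem forbid a sign change inside a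
  region; conversely the cell is convex, hence connected, and a component is maximal.\<close>

lemma region_eq:
  assumes S: "convex S" and R: "R \<in> regions S" and a: "a \<in> R"
  shows "R = {x \<in> S. \<forall>i. 0 < a $ i * x $ i}" (is "R = ?C")
proof
  let ?T = "S - (\<Union>i. {x. x $ i = 0})"
  have con: "connected R" and RT: "R \<subseteq> ?T"
    using in_components_connected[of R ?T] in_components_subset[of R ?T] R
    by (simp_all add: regions_def)
  show "R \<subseteq> ?C"
  proof (safe; rule ccontr)
    fix x i assume x: "x \<in> R" "\<not> 0 < a $ i * x $ i"
    let ?h = "\<lambda>y. a $ i * y $ i"
    have "a $ i \<noteq> 0" using a RT by auto
    then have "0 \<le> ?h a" by simp
    have "connected (?h ` R)"
      by (intro connected_continuous_image con continuous_intros)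
    then have "0 \<in> ?h ` R"
      using connectedD_interval[of "?h ` R" "?h x" "?h a" 0] x a \<open>0 \<le> ?h a\<close> by auto
    then show False using \<open>a $ i \<noteq> 0\<close> RT by auto
  qed (use RT in auto)
  have "a \<in> ?C" using a RT by (auto simp flip: power2_eq_square)
  have "convex (S \<inter> (\<Inter>i. {x. 0 < a $ i * x $ i}))"
  proof (intro convex_Int S convex_INT)
    fix i
    have "{x. 0 < a $ i * x $ i} = {x. (a $ i *\<^sub>R axis i 1) \<bullet> x > 0}"
      by (simp add: inner_axis')
    then show "convex {x. 0 < a $ i * x $ i}" by (simp only: convex_halfspace_gt)
  qed
  also have "S \<inter> (\<Inter>i. {x. 0 < a $ i * x $ i}) = ?C" by auto
  finally have "connected ?C" by (rule convex_connected)
  moreover have "?C \<subseteq> ?T"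
    by (auto dest: less_imp_neq) (metis less_irrefl mult_zero_right)
  ultimately show "?C \<subseteq> R"
    using components_maximal[of R ?T ?C] R \<open>a \<in> ?C\<close> a by (auto simp: regions_def)
qed

text \<open>Compactness yields points of the closure only; a positive product brings them back into
  the region, because on the closure all factors are nonnegative.\<close>

lemma region_if_closure:
  fixes S :: "(real^'n) set"
  assumes S: "closed S" and R: "R = {x \<in> S. \<forall>i. 0 < a $ i * x $ i}"
    and x: "x \<in> closure R" "0 < (\<Prod>i\<in>UNIV. a $ i * x $ i)"
  shows "x \<in> R"
proof -
  have "closed (S \<inter> (\<Inter>i. {x. 0 \<le> a $ i * x $ i}))"
    by (intro closed_Int S closed_INT ballI closed_Collect_le continuous_intros)
  then have "closure R \<subseteq> S \<inter> (\<Inter>i. {x. 0 \<le> a $ i * x $ i})"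
    by (rule closure_minimal[rotated]) (auto simp: R less_imp_le)
  moreover have "a $ i * x $ i \<noteq> 0" for i
  proof
    assume "a $ i * x $ i = 0"
    then have "(\<Prod>i\<in>UNIV. a $ i * x $ i) = 0" by (intro prod_zero bexI[of _ i] finite UNIV_I)
    then show False using x(2) by linarith
  qed
  ultimately show ?thesis
    using x(1) by (auto simp: R order_less_le)
qed

text \<open>Up to a constant factor this is the exponential of the tilted logarithmic sum. Unlike
  the logarithm it is continuous up to the boundary, so it has a maximum on the compact closure; its
  value at \<open>a\<close> is positive, which keeps the maximiser inside \<open>R\<close>.\<close>

lemma tilted_max_exists:
  fixes S :: "(real^'n) set"
  assumes S: "closed S" and R: "R = {x \<in> S. \<forall>i. 0 < a $ i * x $ i}" "bounded R" "a \<in> R"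
  shows "\<exists>x\<in>R. \<forall>y\<in>R. (\<Prod>i\<in>UNIV. a $ i * y $ i) * exp (- (e * (w \<bullet> y)))
      \<le> (\<Prod>i\<in>UNIV. a $ i * x $ i) * exp (- (e * (w \<bullet> x)))"
proof -
  let ?G = "\<lambda>x. (\<Prod>i\<in>UNIV. a $ i * x $ i) * exp (- (e * (w \<bullet> x)))"
  have "compact (closure R)" using R(2) by simp
  moreover have "closure R \<noteq> {}" using R(3) by auto
  moreover have "continuous_on (closure R) ?G" by (intro continuous_intros)
  ultimately obtain x where x: "x \<in> closure R" "\<forall>y\<in>closure R. ?G y \<le> ?G x"
    using continuous_attains_sup by blast
  have "0 < a $ i * a $ i" for i using R(1,3) by blast
  then have "0 < (\<Prod>i\<in>UNIV. a $ i * a $ i)" by (rule prod_pos)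
  then have "0 < ?G a" by simp
  also have "?G a \<le> ?G x" using x(2) R(3) closure_subset by blast
  finally have "x \<in> R"
    by (intro region_if_closure[OF S R(1) x(1)]) (simp add: zero_less_mult_iff)
  then show ?thesis using x(2) closure_subset[of R] by (intro bexI[of _ x]) blast+
qed

text \<open>Along a direction \<open>u\<close> of \<open>L\<close>, the logarithm of the tilted product is critical at its maximum.\<close>

lemma tilted_max_stationary:
  fixes L :: "(real^'n) set"
  assumes L: "subspace L" and R: "R = {x \<in> (\<lambda>x. x + v) ` L. \<forall>i. 0 < a $ i * x $ i}"
    and x: "x \<in> R" and max: "\<And>y. y \<in> R \<Longrightarrow> (\<Prod>i\<in>UNIV. a $ i * y $ i) * exp (- (e * (w \<bullet> y)))
      \<le> (\<Prod>i\<in>UNIV. a $ i * x $ i) * exp (- (e * (w \<bullet> x)))"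
  shows "(\<chi> i. inverse (x $ i)) - e *\<^sub>R w \<in> L\<^sup>\<bottom>"
proof -
  have "u \<bullet> ((\<chi> i. inverse (x $ i)) - e *\<^sub>R w) = 0" if u: "u \<in> L" for u
  proof -
    \<comment> \<open>On an interval around 0 this is the logarithm of the tilted product at
      \<open>x + t *\<^sub>R u\<close>.\<close>
    define h where "h t = (\<Sum>i\<in>UNIV. ln (a $ i * (x $ i + t * u $ i))) - e * (w \<bullet> x + t * (w \<bullet> u))" for t
    have pos: "0 < a $ i * x $ i" for i using x by (simp add: R)
    then have nz: "a $ i \<noteq> 0" "x $ i \<noteq> 0" for i by (metis less_irrefl mult_eq_0_iff)+
    have "eventually (\<lambda>t. \<forall>i. 0 < a $ i * (x $ i + t * u $ i)) (nhds 0)"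
    proof (rule eventually_all_finite)
      fix i
      have "((\<lambda>t. a $ i * (x $ i + t * u $ i)) \<longlongrightarrow> a $ i * (x $ i + 0 * u $ i)) (nhds 0)"
        by (intro tendsto_intros filterlim_ident)
      then show "eventually (\<lambda>t. 0 < a $ i * (x $ i + t * u $ i)) (nhds 0)"
        by (rule order_tendstoD) (use pos in simp)
    qed
    then obtain d where d: "d > 0" "\<And>t i. \<bar>t\<bar> < d \<Longrightarrow> 0 < a $ i * (x $ i + t * u $ i)"
      by (auto simp: eventually_nhds_metric dist_real_def)
    have h_le: "h t \<le> h 0" if t: "\<bar>t\<bar> < d" for t
    proof -
      have ln_tilted: "h t = ln ((\<Prod>i\<in>UNIV. a $ i * (x + t *\<^sub>R u) $ i) * exp (- (e * (w \<bullet> (x + t *\<^sub>R u)))))"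
        if "\<bar>t\<bar> < d" for t
      proof -
        have "0 < a $ i * (x + t *\<^sub>R u) $ i" for i using d(2)[OF that] by simp
        then have "ln (\<Prod>i\<in>UNIV. a $ i * (x + t *\<^sub>R u) $ i) = (\<Sum>i\<in>UNIV. ln (a $ i * (x + t *\<^sub>R u) $ i))"
          "0 < (\<Prod>i\<in>UNIV. a $ i * (x + t *\<^sub>R u) $ i)"
          by (intro ln_prod prod_pos ballI; metis less_irrefl finite)+
        then show ?thesis
          by (simp add: h_def inner_add_right ln_mult_pos del: prod_zero_iff)
      qed
      have "x + t *\<^sub>R u \<in> R"
      proof -
        obtain z where "z \<in> L" "x = z + v" using x by (auto simp: R)
        then have "x + t *\<^sub>R u = (z + t *\<^sub>R u) + v" "z + t *\<^sub>R u \<in> L"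
          using L u by (auto simp: subspace_add subspace_scale)
        then show ?thesis using d(2)[OF t] by (auto simp: R)
      qed
      then have mem: "x + t *\<^sub>R u \<in> R" "\<And>i. 0 < a $ i * (x + t *\<^sub>R u) $ i" by (auto simp: R)
      have "h 0 = ln ((\<Prod>i\<in>UNIV. a $ i * x $ i) * exp (- (e * (w \<bullet> x))))"
        using ln_tilted[of 0] d(1) by simp
      moreover have "0 < (\<Prod>i\<in>UNIV. a $ i * (x + t *\<^sub>R u) $ i)"
        using mem(2) by (intro prod_pos)
      ultimately show ?thesis
        unfolding ln_tilted[OF t] using max[OF mem(1)]
        by (simp only:) (intro ln_mono mult_pos_pos exp_gt_zero)
    qed
    have deriv: "(h has_real_derivative
        (\<Sum>i\<in>UNIV. (a $ i * u $ i) / (a $ i * x $ i)) - e * (w \<bullet> u)) (at 0)"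
      unfolding h_def by (auto intro!: derivative_eq_intros sum.cong simp: pos nz)
    have "(\<Sum>i\<in>UNIV. (a $ i * u $ i) / (a $ i * x $ i)) - e * (w \<bullet> u) = 0"
      by (rule DERIV_local_max[OF deriv d(1)]) (use h_le in auto)
    \<comment> \<open>The reference signs cancel, and the derivative becomes the inner product of
      \<open>u\<close> with \<open>1/x - e w\<close>.\<close>
    moreover have "(a $ i * u $ i) / (a $ i * x $ i) = u $ i * inverse (x $ i)" for i
      using nz by (simp add: field_simps)
    ultimately show ?thesis
      by (simp add: inner_diff_right inner_commute[of w u]) (simp add: inner_vec_def)
  qed
  then show ?thesis
    by (simp add: orthogonal_comp_def orthogonal_def)
qed

section \<open>Uniqueness of the maximiser and passage to the limit\<close>

lemma arithmetic_geometric_mean_square: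
  fixes p q :: real
  shows "p * q \<le> ((p + q) / 2)\<^sup>2" and "p \<noteq> q \<Longrightarrow> p * q < ((p + q) / 2)\<^sup>2"
proof -
  have "((p + q) / 2)\<^sup>2 - p * q = ((p - q) / 2)\<^sup>2"
    by (simp add: power2_eq_square field_simps)
  then show "p * q \<le> ((p + q) / 2)\<^sup>2" "p \<noteq> q \<Longrightarrow> p * q < ((p + q) / 2)\<^sup>2"
    by (smt (verit) zero_le_power2 zero_less_power2 divide_eq_0_iff)+
qed

text \<open>The midpoint \<open>m\<close> of two distinct maximisers would beat them: the inequality
  of the means, applied in each coordinate, gives \<open>P x * P y < P m * P m\<close>.\<close>

lemma product_max_unique:
  fixes S :: "(real^'n) set"
  assumes S: "convex S" and R: "R = {x \<in> S. \<forall>i. 0 < a $ i * x $ i}"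
    and x: "x \<in> R" "\<And>z. z \<in> R \<Longrightarrow> (\<Prod>i\<in>UNIV. a $ i * z $ i) \<le> (\<Prod>i\<in>UNIV. a $ i * x $ i)"
    and y: "y \<in> R" "\<And>z. z \<in> R \<Longrightarrow> (\<Prod>i\<in>UNIV. a $ i * z $ i) \<le> (\<Prod>i\<in>UNIV. a $ i * y $ i)"
  shows "x = y"
proof (rule ccontr)
  assume "x \<noteq> y"
  let ?P = "\<lambda>x. \<Prod>i\<in>UNIV. a $ i * x $ i"
  define m where "m = (1/2) *\<^sub>R x + (1/2) *\<^sub>R y"
  have mi: "a $ i * m $ i = (a $ i * x $ i + a $ i * y $ i) / 2" for i
    by (simp add: m_def field_simps)
  have pos: "0 < a $ i * x $ i" "0 < a $ i * y $ i" for i using x(1) y(1) by (auto simp: R)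
  have "m \<in> S"
    unfolding m_def using x(1) y(1) by (intro convexD[OF S]) (auto simp: R)
  then have m: "m \<in> R" using pos by (auto simp: R mi intro: add_pos_pos)
  obtain i where i: "x $ i \<noteq> y $ i" using \<open>x \<noteq> y\<close> by (auto simp: vec_eq_iff)
  have "(\<Prod>i\<in>UNIV. (a $ i * x $ i) * (a $ i * y $ i)) < (\<Prod>i\<in>UNIV. (a $ i * m $ i)\<^sup>2)"
  proof (rule prod_mono_strict[of i])
    show "(a $ i * x $ i) * (a $ i * y $ i) < (a $ i * m $ i)\<^sup>2"
      unfolding mi using i pos(1)[of i] by (intro arithmetic_geometric_mean_square(2)) auto
    show "0 \<le> (a $ j * x $ j) * (a $ j * y $ j) \<and> (a $ j * x $ j) * (a $ j * y $ j) \<le> (a $ j * m $ j)\<^sup>2" for j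
      unfolding mi using pos[of j] arithmetic_geometric_mean_square(1) by (simp add: less_imp_le)
    show "0 < (a $ j * m $ j)\<^sup>2" for j
      using m by (intro zero_less_power) (simp add: R)
  qed simp_all
  then have "?P x * ?P y < ?P m * ?P m"
    by (simp only: prod.distrib power2_eq_square)
  moreover have "?P m * ?P m \<le> ?P x * ?P y"
    using m pos by (intro mult_mono x(2) y(2) prod_nonneg) (auto simp: R less_imp_le)
  ultimately show False by simp
qed

text \<open>On \<open>R\<close> the logarithmic sum and the logarithm of the product differ by the
  constant sum of \<open>ln \<bar>a $ i\<bar>\<close>, so both have the same maximisers; uniqueness
  resolves the definite description.\<close>

lemma analytic_center_eq:
  fixes S :: "(real^'n) set"
  assumes S: "convex S" and R: "R = {x \<in> S. \<forall>i. 0 < a $ i * x $ i}"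
    and x: "x \<in> R" "\<And>z. z \<in> R \<Longrightarrow> (\<Prod>i\<in>UNIV. a $ i * z $ i) \<le> (\<Prod>i\<in>UNIV. a $ i * x $ i)"
  shows "analytic_center R = x"
proof -
  let ?P = "\<lambda>x. \<Prod>i\<in>UNIV. a $ i * x $ i" and ?f = "\<lambda>x. \<Sum>i\<in>UNIV. ln \<bar>x $ i\<bar>"
  have pos: "0 < ?P y" if "y \<in> R" for y using that by (auto simp: R intro: prod_pos)
  have f: "?f y = ln (?P y) - (\<Sum>i\<in>UNIV. ln \<bar>a $ i\<bar>)" if "y \<in> R" for y
  proof -
    have *: "0 < a $ i * y $ i" for i using that by (simp add: R)
    have "ln (a $ i * y $ i) = ln \<bar>a $ i\<bar> + ln \<bar>y $ i\<bar>" for i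
    proof -
      have "a $ i * y $ i = \<bar>a $ i\<bar> * \<bar>y $ i\<bar>" "a $ i \<noteq> 0" "y $ i \<noteq> 0"
        using *[of i] by (auto simp: abs_mult[symmetric])
      then show ?thesis by (simp add: ln_mult)
    qed
    moreover have "ln (?P y) = (\<Sum>i\<in>UNIV. ln (a $ i * y $ i))"
      using * by (intro ln_prod; metis less_irrefl finite)
    ultimately show ?thesis by (simp add: sum.distrib)
  qed
  have le: "?f y < ?f z \<longleftrightarrow> ?P y < ?P z" if "y \<in> R" "z \<in> R" for y z
    using that pos by (simp add: f)
  show ?thesis
    unfolding analytic_center_def
  proof (rule the_equality)
    show "is_arg_max ?f (\<lambda>x. x \<in> R) x"
      using x by (simp add: is_arg_max_def le not_less cong: conj_cong)
    fix y
    assume y: "is_arg_max ?f (\<lambda>x. x \<in> R) y"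
    then have "y \<in> R" by (simp add: is_arg_max_def)
    then show "y = x"
    proof (rule product_max_unique[OF S R _ _ x])
      show "?P z \<le> ?P y" if "z \<in> R" for z
        using y le[OF \<open>y \<in> R\<close> that] that by (auto simp: is_arg_max_def not_less)
    qed
  qed
qed

text \<open>Stated for an arbitrary subspace \<open>L\<close>, so that it serves both the kernel and
  the row space. The tilted maximisers have a convergent subsequence, and letting the weights tend
  to 0 in their maximality shows that its limit maximises the untilted product.\<close>

lemma analytic_center_limit:
  fixes L :: "(real^'n) set" and v w :: "real^'n"
  assumes L: "subspace L" and R: "R \<in> regions ((\<lambda>x. x + v) ` L)" and bdd: "bounded R"
  obtains e :: "nat \<Rightarrow> real" and y :: "nat \<Rightarrow> real^'n"
    where "e \<longlonglongrightarrow> 0" "\<And>k. e k \<noteq> 0" "y \<longlonglongrightarrow> analytic_center R"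
      "\<And>i. analytic_center R $ i \<noteq> 0" "\<And>k i. y k $ i \<noteq> 0"
      "\<And>k. y k \<in> (\<lambda>x. x + v) ` L" "\<And>k. (\<chi> i. inverse (y k $ i)) - e k *\<^sub>R w \<in> L\<^sup>\<bottom>"
proof -
  let ?S = "(\<lambda>x. x + v) ` L"
  have S: "?S = (+) v ` L" by (auto simp: add.commute)
  have closed: "closed ?S"
    unfolding S by (intro closed_translation closed_subspace L)
  have convex: "convex ?S"
    unfolding S by (intro convex_translation subspace_imp_convex L)
  obtain a where a: "a \<in> R" using R in_components_nonempty unfolding regions_def by blast
  note Req = region_eq[OF convex R a]
  define P where "P x = (\<Prod>i\<in>UNIV. a $ i * x $ i)" for x :: "real^'n"
  \<comment> \<open>\<open>Suc\<close> makes the weight positive already at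
    \<open>k = 0\<close>.\<close>
  define e :: "nat \<Rightarrow> real" where "e k = inverse (real (Suc k))" for k
  have "\<exists>x\<in>R. \<forall>y\<in>R. P y * exp (- (e k * (w \<bullet> y))) \<le> P x * exp (- (e k * (w \<bullet> x)))" for k
    unfolding P_def by (rule tilted_max_exists[OF closed Req bdd a])
  then obtain y where y: "\<And>k. y k \<in> R"
    "\<And>k z. z \<in> R \<Longrightarrow> P z * exp (- (e k * (w \<bullet> z))) \<le> P (y k) * exp (- (e k * (w \<bullet> y k)))"
    by metis
  have "compact (closure R)" using bdd by simp
  then obtain l r where l: "l \<in> closure R" "strict_mono r" "(y \<circ> r) \<longlonglongrightarrow> l"
    using y(1) closure_subset unfolding compact_def by (metis subsetD)
  have er: "(\<lambda>k. e (r k)) \<longlonglongrightarrow> 0"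
    using LIMSEQ_subseq_LIMSEQ[OF LIMSEQ_inverse_real_of_nat l(2)] by (simp add: e_def o_def)
  have yr: "(\<lambda>k. y (r k)) \<longlonglongrightarrow> l" using l(3) by (simp add: o_def)
  \<comment> \<open>Both exponential factors tend to 1, since \<open>z\<close> is fixed and
    \<open>y (r k)\<close> converges.\<close>
  have max: "P z \<le> P l" if z: "z \<in> R" for z
  proof (rule LIMSEQ_le)
    show "(\<lambda>k. P z * exp (- (e (r k) * (w \<bullet> z)))) \<longlonglongrightarrow> P z"
      by (rule tendsto_eq_intros er refl | simp)+
    show "(\<lambda>k. P (y (r k)) * exp (- (e (r k) * (w \<bullet> y (r k))))) \<longlonglongrightarrow> P l"
      unfolding P_def by (rule tendsto_eq_intros er yr refl | simp)+
  qed (use y(2)[OF z] in auto)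
  \<comment> \<open>This excludes that the limit \<open>l\<close> lies on the boundary of the
    region.\<close>
  have "0 < P a" using a unfolding P_def by (subst (asm) Req) (auto intro: prod_pos)
  then have "0 < P l" using max[OF a] by simp
  then have lR: "l \<in> R"
    using region_if_closure[OF closed Req l(1)] by (simp add: P_def)
  have center: "analytic_center R = l"
    using analytic_center_eq[OF convex Req lR] max by (simp add: P_def)
  have nz: "x $ i \<noteq> 0" if "x \<in> R" for x i
    using that by (subst (asm) Req) (auto dest: spec[of _ i])
  show thesis
  proof (rule that[of "\<lambda>k. e (r k)" "\<lambda>k. y (r k)"])
    show "y (r k) \<in> ?S" for k using y(1)[of "r k"] by (subst (asm) Req) auto
    show "(\<chi> i. inverse (y (r k) $ i)) - e (r k) *\<^sub>R w \<in> L\<^sup>\<bottom>" for k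
      using tilted_max_stationary[OF L Req y(1)] y(2) by (simp add: P_def)
  qed (use er yr nz y(1) lR in \<open>auto simp: center e_def\<close>)
qed

section \<open>Points of the central curve at infinity\<close>

lemma subspace_mat_kernel: "subspace (mat_kernel A)" for A :: "real^'n^'d"
  by (auto simp: mat_kernel_def subspace_def matrix_vector_right_distrib scalar_mult_eq_scaleR
      matrix_vector_mult_scaleR)

lemma subspace_row_space: "subspace (row_space A)" for A :: "real^'n^'d"
  by (simp add: row_space_def span_vec_eq)

text \<open>\<open>A *v x\<close> is orthogonal to \<open>y\<close> exactly when \<open>x\<close> is
  orthogonal to \<open>y v* A\<close>. This duality lets the criticality condition in one affine
  space produce a point of the other.\<close>

lemma orthogonal_comp_row_space: "(row_space A)\<^sup>\<bottom> = mat_kernel A" for A :: "real^'n^'d"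
proof -
  have "x \<in> (row_space A)\<^sup>\<bottom> \<longleftrightarrow> (\<forall>y. (A *v x) \<bullet> y = 0)" for x
    by (simp add: orthogonal_comp_def orthogonal_def row_space_eq dot_lmul_matrix inner_commute[of "A *v x"])
  then show ?thesis
    by (auto simp: mat_kernel_def vector_eq_ldot[of _ 0, simplified])
qed

lemma orthogonal_comp_mat_kernel: "(mat_kernel A)\<^sup>\<bottom> = row_space A" for A :: "real^'n^'d"
  using orthogonal_comp_self[OF subspace_row_space] by (simp add: orthogonal_comp_row_space)

text \<open>The factor \<open>1\<close> gives the statement the rescaled shape of
  \<open>central_curve_limit\<close>.\<close>

lemma homog_tendsto:
  assumes "y \<longlonglongrightarrow> l"
  shows "(\<lambda>k. 1 *s homog (cvec (y k))) \<longlonglongrightarrow> homog (cvec l)"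
proof (rule vec_tendstoI)
  fix j
  show "(\<lambda>k. (1 *s homog (cvec (y k))) $ j) \<longlonglongrightarrow> homog (cvec l) $ j"
    using tendsto_vec_nth[OF assms] by (cases j) (auto simp: homog_def cvec_def intro: tendsto_of_real)
qed

text \<open>Multiplying by \<open>e k\<close> clears the diverging factor \<open>1 / e k\<close>:
  the coordinate \<open>None\<close> becomes \<open>e k\<close> and tends to 0, the others become
  \<open>1/y\<close> and converge because \<open>l\<close> has no zero coordinate.\<close>

lemma homog_scaled_inverse_tendsto:
  assumes e: "e \<longlonglongrightarrow> 0" "\<And>k. e k \<noteq> 0" and y: "y \<longlonglongrightarrow> l" "\<And>i. l $ i \<noteq> 0"
  shows "(\<lambda>k. complex_of_real (e k) *s homog (cvec ((1 / e k) *\<^sub>R (\<chi> i. inverse (y k $ i)))))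
    \<longlonglongrightarrow> (\<chi> j. case j of None \<Rightarrow> 0 | Some i \<Rightarrow> complex_of_real (inverse (l $ i)))"
proof (rule vec_tendstoI)
  fix j
  show "(\<lambda>k. (complex_of_real (e k) *s homog (cvec ((1 / e k) *\<^sub>R (\<chi> i. inverse (y k $ i))))) $ j)
    \<longlonglongrightarrow> (\<chi> j. case j of None \<Rightarrow> 0 | Some i \<Rightarrow> complex_of_real (inverse (l $ i))) $ j"
  proof (cases j)
    case None
    then show ?thesis using tendsto_of_real[OF e(1)] by (simp add: homog_def)
  next
    case (Some i)
    have "(\<lambda>k. inverse (y k $ i)) \<longlonglongrightarrow> inverse (l $ i)"
      by (intro tendsto_inverse tendsto_vec_nth y)
    from tendsto_of_real[OF this] show ?thesis
      using e(2) by (simp add: Some homog_def cvec_def del: of_real_inverse)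
  qed
qed

lemma homog_nonzero: "homog x \<noteq> 0" for x :: "complex^'n"
  by (auto simp: vec_eq_iff homog_def intro!: exI[of _ None])

lemma inverse_vec_nonzero:
  fixes l :: "real^'n"
  assumes "\<And>i. l $ i \<noteq> 0"
  shows "(\<chi> j. case j of None \<Rightarrow> 0 | Some i \<Rightarrow> complex_of_real (inverse (l $ i))) \<noteq> 0"
  \<comment> \<open>The coordinate \<open>None\<close> vanishes, so the witness must be some
    \<open>Some i\<close>; any \<open>i\<close> will do.\<close>
  using assms by (auto simp: vec_eq_iff intro!: exI[of _ "Some undefined"])

lemma translate_scaled:
  fixes L :: "(real^'n) set"
  assumes "subspace L" "z - e *\<^sub>R w \<in> L" "e \<noteq> 0"
  shows "(1 / e) *\<^sub>R z \<in> (\<lambda>x. x + w) ` L"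
proof (rule image_eqI)
  show "(1 / e) *\<^sub>R (z - e *\<^sub>R w) \<in> L" by (rule subspace_scale) fact+
  show "(1 / e) *\<^sub>R z = (1 / e) *\<^sub>R (z - e *\<^sub>R w) + w"
    using assms(3) by (simp add: scaleR_diff_right)
qed

section \<open>The curve over analytic centers and vertices\<close>

text \<open>The limit lemma is used with \<open>L\<close> the kernel, translation \<open>g\<close>
  and tilt \<open>c\<close>; criticality then puts \<open>(1/e) (1/y)\<close> into the dual
  space.\<close>

lemma primal_analytic_center:
  fixes A :: "real^'n^'d"
  assumes "R \<in> regions (primal_space A g)" "bounded R"
  shows "\<exists>S. S $ None = 0 \<and> (homog (cvec (analytic_center R)), S) \<in> central_curve A c g"
proof -
  obtain e y where ey: "e \<longlonglongrightarrow> 0" "\<And>k. e k \<noteq> 0" "y \<longlonglongrightarrow> analytic_center R"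
    "\<And>i. analytic_center R $ i \<noteq> 0" "\<And>k i. y k $ i \<noteq> 0"
    "\<And>k. y k \<in> primal_space A g" "\<And>k. (\<chi> i. inverse (y k $ i)) - e k *\<^sub>R c \<in> (mat_kernel A)\<^sup>\<bottom>"
    using analytic_center_limit[OF subspace_mat_kernel[of A] _ assms(2), of g c] assms(1)
    unfolding primal_space_def by metis
  have "(cvec (y k), cvec ((1 / e k) *\<^sub>R (\<chi> i. inverse (y k $ i)))) \<in> affine_central_curve A c g" for k
  proof (rule affine_central_curveI)
    show "(1 / e k) *\<^sub>R (\<chi> i. inverse (y k $ i)) \<in> dual_space A c"
      unfolding dual_space_def using ey(2) ey(7)[of k, unfolded orthogonal_comp_mat_kernel]
      by (intro translate_scaled subspace_row_space)
    show "y k $ i * ((1 / e k) *\<^sub>R (\<chi> i. inverse (y k $ i))) $ i = 1 / e k" for i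
      using ey(5) by simp
  qed (rule ey(6))
  from central_curve_limit[OF this homog_tendsto[OF ey(3)] homog_nonzero
      homog_scaled_inverse_tendsto[OF ey(1-4)] inverse_vec_nonzero[OF ey(4)]]
  show ?thesis by (intro exI conjI) (auto)
qed

text \<open>The roles are exchanged: \<open>L\<close> is the row space, the translation is
  \<open>c\<close> and the tilt is \<open>g\<close>.\<close>

lemma dual_analytic_center:
  fixes A :: "real^'n^'d"
  assumes "R \<in> regions (dual_space A c)" "bounded R"
  shows "\<exists>X. X $ None = 0 \<and> (X, homog (cvec (analytic_center R))) \<in> central_curve A c g"
proof -
  obtain e y where ey: "e \<longlonglongrightarrow> 0" "\<And>k. e k \<noteq> 0" "y \<longlonglongrightarrow> analytic_center R"
    "\<And>i. analytic_center R $ i \<noteq> 0" "\<And>k i. y k $ i \<noteq> 0"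
    "\<And>k. y k \<in> dual_space A c" "\<And>k. (\<chi> i. inverse (y k $ i)) - e k *\<^sub>R g \<in> (row_space A)\<^sup>\<bottom>"
    using analytic_center_limit[OF subspace_row_space[of A] _ assms(2), of c g] assms(1)
    unfolding dual_space_def by metis
  have "(cvec ((1 / e k) *\<^sub>R (\<chi> i. inverse (y k $ i))), cvec (y k)) \<in> affine_central_curve A c g" for k
  proof (rule affine_central_curveI)
    show "(1 / e k) *\<^sub>R (\<chi> i. inverse (y k $ i)) \<in> primal_space A g"
      unfolding primal_space_def using ey(2) ey(7)[of k, unfolded orthogonal_comp_row_space]
      by (intro translate_scaled subspace_mat_kernel)
    show "((1 / e k) *\<^sub>R (\<chi> i. inverse (y k $ i))) $ i * y k $ i = 1 / e k" for i
      using ey(5) by simp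
  qed (rule ey(6))
  from central_curve_limit[OF this homog_scaled_inverse_tendsto[OF ey(1-4)]
      inverse_vec_nonzero[OF ey(4)] homog_tendsto[OF ey(3)] homog_nonzero]
  show ?thesis by (intro exI conjI) (auto)
qed

lemma complementary_central_curve:
  assumes "complementary A c g x s"
  shows "(homog (cvec x), homog (cvec s)) \<in> central_curve A c g"
proof -
  obtain I where I: "x \<in> primal_space A g" "\<forall>j. j \<notin> I \<longrightarrow> x $ j = 0"
      "s \<in> dual_space A c" "\<forall>i\<in>I. s $ i = 0"
    using assms unfolding complementary_def by blast
  have "(cvec x, cvec s) \<in> affine_central_curve A c g"
    \<comment> \<open>The common product is 0: \<open>s\<close> vanishes on \<open>I\<close> and
      \<open>x\<close> off \<open>I\<close>.\<close>
    by (rule affine_central_curveI[OF I(1,3), of 0]) (use I(2,4) in auto)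
  then show ?thesis
    unfolding central_curve_def by (intro hull_inc) auto
qed

theorem theorem33:
  fixes A :: "real^'n^'d" and c g :: "real^'n"
  assumes "CARD('d) < CARD('n)"
    and "rank A = CARD('d)"
    and "generic A c g"
  shows
    "(\<forall>x\<in>vertices (primal_space A g). \<forall>s\<in>vertices (dual_space A c).
        complementary A c g x s \<longrightarrow> (homog (cvec x), homog (cvec s)) \<in> central_curve A c g)
   \<and> (\<forall>R\<in>regions (primal_space A g). bounded R \<longrightarrow>
        (\<exists>S. S $ None = 0 \<and> (homog (cvec (analytic_center R)), S) \<in> central_curve A c g))
   \<and> (\<forall>R\<in>regions (dual_space A c). bounded R \<longrightarrow>
        (\<exists>X. X $ None = 0 \<and> (X, homog (cvec (analytic_center R))) \<in> central_curve A c g))"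
  using complementary_central_curve primal_analytic_center dual_analytic_center by blast

end
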